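(* Let $(U,\Lambda,D,V)$ be an analytic problem and let an MRD discretization of the data space $V$ be given. If $U_M$ is an arbitrary finite-dimensional subspace of $U$, then there is an admissible restriction $(R_N,V_N)$ of the MRD discretization such that $$\|u_M\|_D\le 2\,\|R_ND(u_M)\|_{V_N}\quad\text{for all }u_M\in U_M .$$ This holds without assuming well-posedness. If, in addition, the problem is well-posed with respect to a norm $\|\cdot\|_{WP}$ on $U$ with constant $C$, i.e. $\|u\|_{WP}\le C\|Du\|_V$ for all $u\in U$, then also $$\|u_M\|_{WP}\le 2C\,\|R_ND(u_M)\|_{V_N}\quad\text{for all }u_M\in U_M .$$
   Context: Analytic problem: a real normed linear space $U$ (objects), a set $\Lambda$ of linear functionals on $U$, the data map $D:U\to\mathbb{R}^\Lambda$, $D(u)=\{\lambda(u)\}_{\lambda\in\Lambda}$, and a normed data space $V\subseteq\mathbb{R}^\Lambda$ containing $D(U)$ whose norm satisfies $\|Du\|_V=\sup_{\lambda\in\Lambda}|\lambda(u)|<\infty$ for all $u\in U$. Put $\|u\|_D:=\|Du\|_V$ (a seminorm on $U$). MRD (monotone refinable dense) discretization of a normed data space $V$: a (nonempty) set of pairs $(R_N,V_N)$, called admissible restrictions, together with a relation $\preceq$ (refinement) on them, such that (1) each $V_N$ is a finite-dimensional real normed space with norm $\|\cdot\|_{V_N}$; (2) each $R_N:V\to V_N$ is linear; (3) (monotonicity) $(R_M,V_M)\preceq(R_N,V_N)$ implies $\|R_Mv\|_{V_M}\le\|R_Nv\|_{V_N}$ for all $v\in V$; (4) (refinement) for any two admissible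 restrictions $(R_M,V_M)$, $(R_N,V_N)$ there is an admissible restriction $(R_P,V_P)$ with $(R_M,V_M)\preceq(R_P,V_P)$ and $(R_N,V_N)\preceq(R_P,V_P)$; (5) (density) $\|v\|_V=\sup\|R_Nv\|_{V_N}$ for all $v\in V$, the supremum being over all admissible restrictions. *)

theory Defs
  imports "HOL-Analysis.Analysis" "HOL-Library.Function_Algebras"
begin

text \<open>Pointwise scalar multiplication; the additive structure is that of
  \<^theory>\<open>HOL-Library.Function_Algebras\<close>.\<close>

instantiation "fun" :: (type, real_vector) real_vector
begin

definition scaleR_fun :: "real \<Rightarrow> ('a \<Rightarrow> 'b) \<Rightarrow> 'a \<Rightarrow> 'b"
  where "scaleR_fun c f = (\<lambda>x. c *\<^sub>R f x)"

instance
  by standard (simp_all add: scaleR_fun_def fun_eq_iff algebra_simps)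

end

text \<open>A normed space whose vectors form a subspace of an ambient real vector space. The norm
  is its own, and its values outside the carrier are irrelevant. This allows spaces
  of different dimensions with different norms to be collected in one set.\<close>

record 'a nspace =
  vecs :: "'a set"
  nrm :: "'a \<Rightarrow> real"

definition normed_space :: "'a::real_vector nspace \<Rightarrow> bool"
  where "normed_space X \<longleftrightarrow>
    subspace (vecs X) \<and>
    (\<forall>x\<in>vecs X. 0 \<le> nrm X x \<and> (nrm X x = 0 \<longleftrightarrow> x = 0)) \<and>
    (\<forall>x\<in>vecs X. \<forall>c. nrm X (c *\<^sub>R x) = \<bar>c\<bar> * nrm X x) \<and>
    (\<forall>x\<in>vecs X. \<forall>y\<in>vecs X. nrm X (x + y) \<le> nrm X x + nrm X y)"

definition fin_dim :: "'a::real_vector set \<Rightarrow> bool"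
  where "fin_dim S \<longleftrightarrow> (\<exists>B. finite B \<and> S = span B)"

definition linear_map_between :: "'a::real_vector set \<Rightarrow> 'b::real_vector set \<Rightarrow> ('a \<Rightarrow> 'b) \<Rightarrow> bool"
  where "linear_map_between S T f \<longleftrightarrow>
    f \<in> S \<rightarrow> T \<and>
    (\<forall>x\<in>S. \<forall>y\<in>S. f (x + y) = f x + f y) \<and>
    (\<forall>x\<in>S. \<forall>c. f (c *\<^sub>R x) = c *\<^sub>R f x)"

text \<open>The elements of $\mathbb{R}^\Lambda$ are represented by the functions that vanish outside
  \<open>\<Lambda>\<close>, so that the pointwise operations are those of $\mathbb{R}^\Lambda$.\<close>

definition data_vectors :: "'l set \<Rightarrow> ('l \<Rightarrow> real) set"
  where "data_vectors \<Lambda> = {f. \<forall>l. l \<notin> \<Lambda> \<longrightarrow> f l = 0}"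

definition data_map :: "('u \<Rightarrow> real) set \<Rightarrow> 'u \<Rightarrow> ('u \<Rightarrow> real) \<Rightarrow> real"
  where "data_map \<Lambda> u = (\<lambda>l. if l \<in> \<Lambda> then l u else 0)"

text \<open>The supremum is taken in $[0,\infty]$: the equation then says that it is finite, and
  it is 0 for empty \<open>\<Lambda>\<close>. The functionals need not be continuous.\<close>

definition analytic_problem ::
    "('u::real_normed_vector \<Rightarrow> real) set \<Rightarrow> (('u \<Rightarrow> real) \<Rightarrow> real) nspace \<Rightarrow> bool"
  where "analytic_problem \<Lambda> V \<longleftrightarrow>
    (\<forall>l\<in>\<Lambda>. linear l) \<and>
    normed_space V \<and> vecs V \<subseteq> data_vectors \<Lambda> \<and>
    range (data_map \<Lambda>) \<subseteq> vecs V \<and>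
    (\<forall>u. ennreal (nrm V (data_map \<Lambda> u)) = (SUP l\<in>\<Lambda>. ennreal \<bar>l u\<bar>))"

definition norm_D ::
    "('u \<Rightarrow> real) set \<Rightarrow> (('u \<Rightarrow> real) \<Rightarrow> real) nspace \<Rightarrow> 'u \<Rightarrow> real"
  where "norm_D \<Lambda> V u = nrm V (data_map \<Lambda> u)"

definition well_posed ::
    "('u::real_normed_vector \<Rightarrow> real) set \<Rightarrow> (('u \<Rightarrow> real) \<Rightarrow> real) nspace \<Rightarrow> ('u \<Rightarrow> real) \<Rightarrow> real \<Rightarrow> bool"
  where "well_posed \<Lambda> V norm_WP C \<longleftrightarrow>
    normed_space \<lparr>vecs = UNIV, nrm = norm_WP\<rparr> \<and>
    (\<forall>u. norm_WP u \<le> C * nrm V (data_map \<Lambda> u))"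

type_synonym ('v, 'w) restriction = "('v \<Rightarrow> 'w) \<times> 'w nspace"

text \<open>Refinement is an arbitrary relation; no order axioms are imposed on it. As above, the
  supremum in the density condition is taken in $[0,\infty]$.\<close>

definition MRD_discretization ::
    "'v::real_vector nspace \<Rightarrow> ('v, 'w::real_vector) restriction set \<Rightarrow>
     (('v, 'w) restriction \<Rightarrow> ('v, 'w) restriction \<Rightarrow> bool) \<Rightarrow> bool"
  where "MRD_discretization V \<A> prec \<longleftrightarrow>
    \<A> \<noteq> {} \<and>
    (\<forall>(R, W)\<in>\<A>. normed_space W \<and> fin_dim (vecs W) \<and> linear_map_between (vecs V) (vecs W) R) \<and>
    (\<forall>(R, W)\<in>\<A>. \<forall>(R', W')\<in>\<A>. prec (R, W) (R', W') \<longrightarrow>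
       (\<forall>v\<in>vecs V. nrm W (R v) \<le> nrm W' (R' v))) \<and>
    (\<forall>M\<in>\<A>. \<forall>N\<in>\<A>. \<exists>P\<in>\<A>. prec M P \<and> prec N P) \<and>
    (\<forall>v\<in>vecs V. ennreal (nrm V v) = (SUP (R, W)\<in>\<A>. ennreal (nrm W (R v))))"

end

theory Submission
  imports Defs
begin

text \<open>
  The trial space \<open>U\<^sub>M\<close> enters only through its image \<open>F = D U\<^sub>M\<close>, a finite-dimensional subspace
  of the data space. On \<open>F\<close> the seminorms \<open>v \<mapsto> \<parallel>R\<^sub>N v\<parallel>\<close> form a family that is directed upwards,
  by refinement and monotonicity, and whose pointwise supremum is \<open>\<parallel>v\<parallel>\<close>, by density. As
  \<open>\<parallel>v\<parallel> / 2 < \<parallel>v\<parallel>\<close> for \<open>v \<noteq> 0\<close>, each nonzero \<open>v\<close> has some restriction with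
  \<open>\<parallel>v\<parallel> / 2 < \<parallel>R\<^sub>N v\<parallel>\<close>. The factor 2 is what makes this inequality strict, hence stable under
  small changes of \<open>v\<close>. Compactness of the unit sphere of \<open>F\<close> then leaves finitely many
  restrictions, and a common refinement of these works for all of \<open>F\<close>: this is Dini's argument,
  given for arbitrary directed families of seminorms in
  \<open>directed_seminorms_dominate_uniformly\<close>.

  Neither \<open>F\<close> nor the norms on it carry a topology of the type system. Compactness is therefore
  used for the coordinate vectors with respect to a basis of \<open>F\<close>, in the product topology on
  functions, and a seminorm on \<open>F\<close> is a continuous function of the coordinates
  (\<open>continuous_on_seminorm_of_combination\<close>).

  The estimate for \<open>\<parallel>u\<parallel>\<^sub>W\<^sub>P\<close> follows by composing the well-posedness inequality with the one just
  obtained.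
\<close>

section \<open>Seminorms on a subspace\<close>

definition seminorm_on :: "'v::real_vector set \<Rightarrow> ('v \<Rightarrow> real) \<Rightarrow> bool"
  where "seminorm_on S p \<longleftrightarrow>
    (\<forall>x\<in>S. \<forall>c. p (c *\<^sub>R x) = \<bar>c\<bar> * p x) \<and>
    (\<forall>x\<in>S. \<forall>y\<in>S. p (x + y) \<le> p x + p y)"

lemma seminorm_on_subset: "seminorm_on S p \<Longrightarrow> T \<subseteq> S \<Longrightarrow> seminorm_on T p"
  unfolding seminorm_on_def by blast

lemma seminorm_on_scale:
  assumes "seminorm_on S p" and "0 \<le> a"
  shows "seminorm_on S (\<lambda>v. a * p v)"
  using assms unfolding seminorm_on_def
  by (auto simp: mult.left_commute simp flip: distrib_left intro: mult_left_mono)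

lemma seminorm_on_zero:
  assumes "seminorm_on S p" and "subspace S"
  shows "p 0 = 0"
proof -
  have "p (0 *\<^sub>R 0) = \<bar>0\<bar> * p 0"
    using assms subspace_0 unfolding seminorm_on_def by blast
  then show ?thesis
    by simp
qed

lemma seminorm_on_nonneg:
  assumes p: "seminorm_on S p" and S: "subspace S" and x: "x \<in> S"
  shows "0 \<le> p x"
proof -
  have "p (x + (-1) *\<^sub>R x) \<le> p x + p ((-1) *\<^sub>R x)"
    using p x subspace_scale[OF S x] unfolding seminorm_on_def by blast
  moreover have "p ((-1) *\<^sub>R x) = \<bar>-1\<bar> * p x"
    using p x unfolding seminorm_on_def by blast
  ultimately show ?thesis
    using seminorm_on_zero[OF p S] by simp
qed

lemma seminorm_on_combination_le:
  assumes p: "seminorm_on S p" and S: "subspace S" and B: "finite B" "B \<subseteq> S"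
  shows "p (\<Sum>b\<in>B. c b *\<^sub>R b) \<le> (\<Sum>b\<in>B. \<bar>c b\<bar> * p b)"
  using B
proof (induction B rule: finite_induct)
  case empty
  then show ?case
    by (simp add: seminorm_on_zero[OF p S])
next
  case (insert x B)
  have "p (c x *\<^sub>R x + (\<Sum>b\<in>B. c b *\<^sub>R b)) \<le> p (c x *\<^sub>R x) + p (\<Sum>b\<in>B. c b *\<^sub>R b)"
    using p insert.prems S unfolding seminorm_on_def
    by (meson insert_subset subspace_scale subspace_sum subset_iff)
  moreover have "p (c x *\<^sub>R x) = \<bar>c x\<bar> * p x"
    using p insert.prems unfolding seminorm_on_def by blast
  ultimately show ?case
    using insert by auto
qed

lemma seminorm_on_diff_le:
  assumes p: "seminorm_on S p" and S: "subspace S" and xy: "x \<in> S" "y \<in> S"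
  shows "\<bar>p x - p y\<bar> \<le> p (x - y)"
proof -
  have d: "x - y \<in> S"
    using S xy by (rule subspace_diff)
  have "p (y + (x - y)) \<le> p y + p (x - y)"
    using p xy d unfolding seminorm_on_def by blast
  moreover have "p (x + (-1) *\<^sub>R (x - y)) \<le> p x + p ((-1) *\<^sub>R (x - y))"
    using p xy subspace_scale[OF S d] unfolding seminorm_on_def by blast
  moreover have "p ((-1) *\<^sub>R (x - y)) = \<bar>-1\<bar> * p (x - y)"
    using p d unfolding seminorm_on_def by blast
  ultimately show ?thesis
    by simp
qed

section \<open>Compactness in coordinates\<close>

text \<open>The weighted \<open>\<ell>\<^sup>1\<close> bound \<open>\<bar>p v\<^sub>c - p v\<^sub>d\<bar> \<le> (\<Sum>b\<in>B. \<bar>c b - d b\<bar> * p b)\<close> involves finitely many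
  coordinates only, and its right-hand side tends to 0 as \<open>c\<close> tends to \<open>d\<close> coordinatewise.\<close>

lemma continuous_on_seminorm_of_combination:
  assumes p: "seminorm_on S p" and S: "subspace S" and B: "finite B" "B \<subseteq> S"
  shows "continuous_on UNIV (\<lambda>c. p (\<Sum>b\<in>B. c b *\<^sub>R b))"
  unfolding continuous_on_def
proof
  fix d :: "'a \<Rightarrow> real"
  have mem: "(\<Sum>b\<in>B. c b *\<^sub>R b) \<in> S" for c
    using B by (intro subspace_sum[OF S] subspace_scale[OF S]) auto
  have coord: "((\<lambda>c. c b) \<longlongrightarrow> d b) (at d)" for b
    using continuous_on_product_coordinates[of b] by (auto simp: continuous_on_def)
  have "((\<lambda>c. \<Sum>b\<in>B. \<bar>c b - d b\<bar> * p b) \<longlongrightarrow> (\<Sum>b\<in>B. \<bar>d b - d b\<bar> * p b)) (at d)"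
    by (intro tendsto_intros coord)
  then have lim: "((\<lambda>c. \<Sum>b\<in>B. \<bar>c b - d b\<bar> * p b) \<longlongrightarrow> 0) (at d)"
    by simp
  have "norm (p (\<Sum>b\<in>B. c b *\<^sub>R b) - p (\<Sum>b\<in>B. d b *\<^sub>R b)) \<le> (\<Sum>b\<in>B. \<bar>c b - d b\<bar> * p b)" for c
  proof -
    have "\<bar>p (\<Sum>b\<in>B. c b *\<^sub>R b) - p (\<Sum>b\<in>B. d b *\<^sub>R b)\<bar>
        \<le> p ((\<Sum>b\<in>B. c b *\<^sub>R b) - (\<Sum>b\<in>B. d b *\<^sub>R b))"
      by (rule seminorm_on_diff_le[OF p S mem mem])
    also have "(\<Sum>b\<in>B. c b *\<^sub>R b) - (\<Sum>b\<in>B. d b *\<^sub>R b) = (\<Sum>b\<in>B. (c b - d b) *\<^sub>R b)"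
      by (simp add: sum_subtractf scaleR_left_diff_distrib)
    also have "p \<dots> \<le> (\<Sum>b\<in>B. \<bar>c b - d b\<bar> * p b)"
      by (rule seminorm_on_combination_le[OF p S B])
    finally show ?thesis
      by simp
  qed
  then have "((\<lambda>c. p (\<Sum>b\<in>B. c b *\<^sub>R b) - p (\<Sum>b\<in>B. d b *\<^sub>R b)) \<longlongrightarrow> 0) (at d)"
    by (intro Lim_null_comparison[OF _ lim] always_eventually) simp
  then show "((\<lambda>c. p (\<Sum>b\<in>B. c b *\<^sub>R b)) \<longlongrightarrow> p (\<Sum>b\<in>B. d b *\<^sub>R b)) (at d)"
    by (rule LIM_zero_cancel)
qed

text \<open>The sphere lies in a product of compact intervals, degenerate outside \<open>B\<close>, and is cut out
  of it by a continuous equation in finitely many coordinates.\<close>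

lemma compact_coordinate_sphere:
  fixes B :: "'b set"
  assumes B: "finite B"
  shows "compact {c :: 'b \<Rightarrow> real. (\<forall>b. b \<notin> B \<longrightarrow> c b = 0) \<and> (\<Sum>b\<in>B. \<bar>c b\<bar>) = 1}"
proof -
  let ?I = "\<lambda>b. if b \<in> B then {-1..1::real} else {0}"
  have "compactin (product_topology (\<lambda>_. euclidean) UNIV) (Pi\<^sub>E UNIV ?I)"
    by (auto simp: compactin_PiE)
  then have box: "compact (Pi\<^sub>E UNIV ?I)"
    by (simp add: euclidean_product_topology)
  have "closed {c :: 'b \<Rightarrow> real. (\<Sum>b\<in>B. \<bar>c b\<bar>) = 1}"
    by (intro closed_Collect_eq continuous_intros continuous_on_product_coordinates)
  with box have "compact (Pi\<^sub>E UNIV ?I \<inter> {c. (\<Sum>b\<in>B. \<bar>c b\<bar>) = 1})"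
    by (rule compact_Int_closed)
  moreover have "Pi\<^sub>E UNIV ?I \<inter> {c. (\<Sum>b\<in>B. \<bar>c b\<bar>) = 1}
      = {c. (\<forall>b. b \<notin> B \<longrightarrow> c b = 0) \<and> (\<Sum>b\<in>B. \<bar>c b\<bar>) = 1}"
  proof -
    have "\<bar>c b\<bar> \<le> 1" if "(\<Sum>b\<in>B. \<bar>c b\<bar>) = 1" "b \<in> B" for c :: "'b \<Rightarrow> real" and b
      using member_le_sum[of b B "\<lambda>b. \<bar>c b\<bar>"] that B by simp
    then show ?thesis
      by (auto simp: PiE_iff abs_le_iff split: if_splits)
  qed
  ultimately show ?thesis
    by simp
qed

section \<open>Directed families of seminorms\<close>

lemma directed_finite_upper_bound:
  fixes q :: "'i \<Rightarrow> 'v \<Rightarrow> real"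
  assumes ne: "I \<noteq> {}"
    and dir: "\<And>i j. i \<in> I \<Longrightarrow> j \<in> I \<Longrightarrow> \<exists>k\<in>I. \<forall>v\<in>S. q i v \<le> q k v \<and> q j v \<le> q k v"
    and J: "finite J" "J \<subseteq> I"
  shows "\<exists>k\<in>I. \<forall>i\<in>J. \<forall>v\<in>S. q i v \<le> q k v"
  using J
proof (induction J rule: finite_induct)
  case empty
  then show ?case
    using ne by blast
next
  case (insert j J)
  then obtain k where k: "k \<in> I" "\<forall>i\<in>J. \<forall>v\<in>S. q i v \<le> q k v"
    by auto
  obtain l where "l \<in> I" "\<forall>v\<in>S. q j v \<le> q l v \<and> q k v \<le> q l v"
    using dir[of j k] k insert.prems by auto
  with k show ?case
    by (intro bexI[of _ l]) (auto intro: order_trans)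
qed

text \<open>A Dini theorem for seminorms. The sets \<open>{c. p v\<^sub>c < q i v\<^sub>c}\<close> are open and cover the sphere
  of coordinates, since independence makes \<open>v\<^sub>c\<close> nonzero there; by compactness finitely many of
  them suffice, and an upper bound of the corresponding \<open>q i\<close> dominates \<open>p\<close> on the sphere.
  Homogeneity carries the inequality over to the whole subspace.\<close>

lemma directed_seminorms_dominate_uniformly:
  fixes S :: "'v::real_vector set" and p :: "'v \<Rightarrow> real" and q :: "'i \<Rightarrow> 'v \<Rightarrow> real"
  assumes fin: "fin_dim S"
    and p: "seminorm_on S p" and q: "\<And>i. i \<in> I \<Longrightarrow> seminorm_on S (q i)"
    and ne: "I \<noteq> {}"
    and dir: "\<And>i j. i \<in> I \<Longrightarrow> j \<in> I \<Longrightarrow> \<exists>k\<in>I. \<forall>v\<in>S. q i v \<le> q k v \<and> q j v \<le> q k v"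
    and pointwise: "\<And>v. v \<in> S \<Longrightarrow> v \<noteq> 0 \<Longrightarrow> \<exists>i\<in>I. p v < q i v"
  shows "\<exists>k\<in>I. \<forall>v\<in>S. p v \<le> q k v"
proof -
  obtain G where G: "finite G" "S = span G"
    using fin by (auto simp: fin_dim_def)
  obtain B where BG: "B \<subseteq> G" and ind: "independent B" and "G \<subseteq> span B"
    using maximal_independent_subset by blast
  then have spanB: "span B = S"
    using G(2) by (metis span_eq span_superset subset_trans)
  have B: "finite B" "B \<subseteq> S"
    using BG G(1) finite_subset spanB span_superset[of B] by auto
  have S: "subspace S"
    using G(2) by simp
  define comb where "comb c = (\<Sum>b\<in>B. c b *\<^sub>R b)" for c :: "'v \<Rightarrow> real"
  define K where "K = {c :: 'v \<Rightarrow> real. (\<forall>b. b \<notin> B \<longrightarrow> c b = 0) \<and> (\<Sum>b\<in>B. \<bar>c b\<bar>) = 1}"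
  have comb_mem: "comb c \<in> S" for c
    unfolding comb_def using B by (intro subspace_sum[OF S] subspace_scale[OF S]) auto
  have comb_nz: "comb c \<noteq> 0" if "c \<in> K" for c
  proof
    assume "comb c = 0"
    then have "c b = 0" if "b \<in> B" for b
      using independentD[OF ind B(1)] that by (simp add: comb_def)
    then have "(\<Sum>b\<in>B. \<bar>c b\<bar>) = 0"
      by simp
    with \<open>c \<in> K\<close> show False
      by (simp add: K_def)
  qed
  have "compact K"
    unfolding K_def using B(1) by (rule compact_coordinate_sphere)
  moreover have "open {c. p (comb c) < q i (comb c)}" if "i \<in> I" for i
    unfolding comb_def
    by (intro open_Collect_less continuous_on_seminorm_of_combination[OF _ S B] p q that)
  moreover have "K \<subseteq> (\<Union>i\<in>I. {c. p (comb c) < q i (comb c)})"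
    using pointwise comb_mem comb_nz by blast
  ultimately obtain J where J: "J \<subseteq> I" "finite J"
    and cover: "K \<subseteq> (\<Union>i\<in>J. {c. p (comb c) < q i (comb c)})"
    by (rule compactE_image)
  obtain k where k: "k \<in> I" "\<forall>i\<in>J. \<forall>v\<in>S. q i v \<le> q k v"
    using directed_finite_upper_bound[OF ne dir J(2,1)] by blast
  have sphere: "p (comb c) \<le> q k (comb c)" if "c \<in> K" for c
  proof -
    obtain i where "i \<in> J" "p (comb c) < q i (comb c)"
      using cover \<open>c \<in> K\<close> by auto
    moreover have "q i (comb c) \<le> q k (comb c)"
      using k(2) \<open>i \<in> J\<close> comb_mem by blast
    ultimately show ?thesis
      by linarith
  qed
  have "p v \<le> q k v" if "v \<in> S" for v
  proof -
    obtain c where c: "v = comb c"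
      using \<open>v \<in> S\<close> spanB span_finite[OF B(1)] by (auto simp: comb_def)
    define m where "m = (\<Sum>b\<in>B. \<bar>c b\<bar>)"
    show ?thesis
    proof (cases "m = 0")
      case True
      then have "\<forall>b\<in>B. c b = 0"
        using B(1) by (simp add: m_def sum_nonneg_eq_0_iff)
      then have "v = 0"
        by (simp add: c comb_def)
      then show ?thesis
        using seminorm_on_zero[OF p S] seminorm_on_zero[OF q[OF k(1)] S] by simp
    next
      case False
      then have m: "m > 0"
        unfolding m_def by (simp add: less_le sum_nonneg)
      define d where "d b = (if b \<in> B then c b / m else 0)" for b
      have "(\<Sum>b\<in>B. \<bar>d b\<bar>) = (\<Sum>b\<in>B. \<bar>c b\<bar>) / m"
        using m by (simp add: d_def sum_divide_distrib)
      then have "d \<in> K"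
        using m by (simp add: K_def d_def m_def)
      have v: "v = m *\<^sub>R comb d"
        using m by (simp add: c comb_def d_def scaleR_sum_right)
      have "p v = m * p (comb d)" "q k v = m * q k (comb d)"
        using p q[OF k(1)] comb_mem m v by (auto simp: seminorm_on_def)
      then show ?thesis
        using sphere[OF \<open>d \<in> K\<close>] m by simp
    qed
  qed
  with k(1) show ?thesis
    by blast
qed

section \<open>Restrictions of a data space\<close>

lemma seminorm_on_nrm: "normed_space X \<Longrightarrow> seminorm_on (vecs X) (nrm X)"
  by (auto simp: normed_space_def seminorm_on_def)

lemma seminorm_on_nrm_comp:
  assumes W: "normed_space W" and R: "linear_map_between S (vecs W) R"
  shows "seminorm_on S (\<lambda>v. nrm W (R v))"
  using seminorm_on_nrm[OF W] R unfolding seminorm_on_def linear_map_between_def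
  by (simp add: Pi_iff)

lemma fin_dim_linear_image:
  assumes "linear f" and "fin_dim S"
  shows "fin_dim (f ` S)"
proof -
  obtain B where "finite B" "S = span B"
    using assms(2) by (auto simp: fin_dim_def)
  then have "f ` S = span (f ` B)"
    by (simp add: linear_span_image[OF assms(1)])
  then show ?thesis
    using \<open>finite B\<close> by (auto simp: fin_dim_def)
qed

lemma linear_data_map:
  assumes "\<forall>l\<in>\<Lambda>. linear l"
  shows "linear (data_map \<Lambda>)"
  using assms
  by (intro linearI) (auto simp: data_map_def fun_eq_iff scaleR_fun_def linear_add linear_scale)

lemma MRD_restriction_le_norm:
  assumes V: "normed_space V" and MRD: "MRD_discretization V \<A> prec"
    and RW: "(R, W) \<in> \<A>" and v: "v \<in> vecs V"
  shows "nrm W (R v) \<le> nrm V v"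
proof -
  have "ennreal (nrm W (R v)) \<le> (SUP (R, W)\<in>\<A>. ennreal (nrm W (R v)))"
    using RW by (intro SUP_upper2[of "(R, W)"]) auto
  also have "\<dots> = ennreal (nrm V v)"
    using MRD v by (simp add: MRD_discretization_def)
  finally show ?thesis
    using V v by (simp add: normed_space_def)
qed

text \<open>The Dini argument is applied to half the norm, which density places strictly below the
  supremum of the restricted norms at every nonzero vector. At the zero vector no strict
  inequality can hold, which is why the argument runs on a sphere.\<close>

lemma MRD_finite_dimensional_half_norm:
  assumes V: "normed_space V" and MRD: "MRD_discretization V \<A> prec"
    and F: "F \<subseteq> vecs V" "fin_dim F"
  shows "\<exists>(R, W)\<in>\<A>. \<forall>v\<in>F. nrm V v \<le> 2 * nrm W (R v)"
proof -
  let ?q = "\<lambda>(R, W) v. nrm W (R v)"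
  have restr: "normed_space W \<and> linear_map_between (vecs V) (vecs W) R" if "(R, W) \<in> \<A>" for R W
    using MRD that by (auto simp: MRD_discretization_def)
  have mono: "?q M v \<le> ?q N v" if "M \<in> \<A>" "N \<in> \<A>" "prec M N" "v \<in> vecs V" for M N v
  proof -
    have "\<forall>(R, W)\<in>\<A>. \<forall>(R', W')\<in>\<A>. prec (R, W) (R', W') \<longrightarrow>
        (\<forall>v\<in>vecs V. nrm W (R v) \<le> nrm W' (R' v))"
      using MRD by (simp add: MRD_discretization_def)
    from bspec[OF this that(1)] that(2-4) show ?thesis
      by (cases M, cases N) auto
  qed
  have refine: "\<exists>P\<in>\<A>. prec M P \<and> prec N P" if "M \<in> \<A>" "N \<in> \<A>" for M N
    using MRD that by (simp add: MRD_discretization_def)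
  have "\<exists>N\<in>\<A>. \<forall>v\<in>F. 1 / 2 * nrm V v \<le> ?q N v"
  proof (rule directed_seminorms_dominate_uniformly[OF F(2)])
    show "seminorm_on F (\<lambda>v. 1 / 2 * nrm V v)"
      using seminorm_on_subset[OF seminorm_on_nrm[OF V] F(1)] by (rule seminorm_on_scale) simp
    show "seminorm_on F (?q N)" if "N \<in> \<A>" for N
    proof (cases N)
      case (Pair R W)
      with restr that have "seminorm_on (vecs V) (\<lambda>v. nrm W (R v))"
        by (intro seminorm_on_nrm_comp) auto
      then show ?thesis
        using seminorm_on_subset[OF _ F(1)] by (simp add: Pair)
    qed
    show "\<A> \<noteq> {}"
      using MRD by (simp add: MRD_discretization_def)
    show "\<exists>P\<in>\<A>. \<forall>v\<in>F. ?q M v \<le> ?q P v \<and> ?q N v \<le> ?q P v" if "M \<in> \<A>" "N \<in> \<A>" for M N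
    proof -
      obtain P where "P \<in> \<A>" "prec M P" "prec N P"
        using refine[OF \<open>M \<in> \<A>\<close> \<open>N \<in> \<A>\<close>] by blast
      then show ?thesis
        using mono[OF \<open>M \<in> \<A>\<close> \<open>P \<in> \<A>\<close>] mono[OF \<open>N \<in> \<A>\<close> \<open>P \<in> \<A>\<close>] F(1)
        by (intro bexI[of _ P]) auto
    qed
  next
    fix v assume v: "v \<in> F" "v \<noteq> 0"
    then have "0 < nrm V v"
      using V F(1) by (auto simp: normed_space_def less_le)
    then have "ennreal (1 / 2 * nrm V v) < ennreal (nrm V v)"
      by (simp add: ennreal_less_iff)
    also have "\<dots> = (SUP N\<in>\<A>. ennreal (?q N v))"
      using MRD v(1) F(1) by (auto simp: MRD_discretization_def case_prod_unfold)
    finally obtain N where "N \<in> \<A>" "ennreal (1 / 2 * nrm V v) < ennreal (?q N v)"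
      by (auto simp: less_SUP_iff)
    then show "\<exists>N\<in>\<A>. 1 / 2 * nrm V v < ?q N v"
      using \<open>0 < nrm V v\<close> by (intro bexI[of _ N]) (auto simp: ennreal_less_iff)
  qed
  then obtain N where "N \<in> \<A>" "\<forall>v\<in>F. 1 / 2 * nrm V v \<le> ?q N v"
    by blast
  then show ?thesis
    by (intro bexI[of _ N]) (auto simp: case_prod_unfold)
qed

theorem theorem5p3:
  fixes \<Lambda> :: "('u::real_normed_vector \<Rightarrow> real) set"
    and V :: "(('u \<Rightarrow> real) \<Rightarrow> real) nspace"
    and \<A> :: "(('u \<Rightarrow> real) \<Rightarrow> real, 'w::real_vector) restriction set"
    and prec :: "(('u \<Rightarrow> real) \<Rightarrow> real, 'w) restriction \<Rightarrow>
                    (('u \<Rightarrow> real) \<Rightarrow> real, 'w) restriction \<Rightarrow> bool"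
    and U\<^sub>M :: "'u set"
  assumes "analytic_problem \<Lambda> V"
    and "MRD_discretization V \<A> prec"
    and "subspace U\<^sub>M" and "fin_dim U\<^sub>M"
  shows "\<exists>(R, W)\<in>\<A>.
    (\<forall>u\<in>U\<^sub>M. norm_D \<Lambda> V u \<le> 2 * nrm W (R (data_map \<Lambda> u))) \<and>
    (\<forall>norm_WP C. well_posed \<Lambda> V norm_WP C \<longrightarrow>
      (\<forall>u\<in>U\<^sub>M. norm_WP u \<le> 2 * C * nrm W (R (data_map \<Lambda> u))))"
proof -
  have lin: "\<forall>l\<in>\<Lambda>. linear l" and V: "normed_space V" and D: "data_map \<Lambda> u \<in> vecs V" for u
    using assms(1) by (auto simp: analytic_problem_def)
  have "data_map \<Lambda> ` U\<^sub>M \<subseteq> vecs V"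
    using D by blast
  moreover have "fin_dim (data_map \<Lambda> ` U\<^sub>M)"
    using linear_data_map[OF lin] assms(4) by (rule fin_dim_linear_image)
  ultimately have "\<exists>(R, W)\<in>\<A>. \<forall>v\<in>data_map \<Lambda> ` U\<^sub>M. nrm V v \<le> 2 * nrm W (R v)"
    by (rule MRD_finite_dimensional_half_norm[OF V assms(2)])
  then obtain R W where RW: "(R, W) \<in> \<A>"
    and half: "\<And>u. u \<in> U\<^sub>M \<Longrightarrow> nrm V (data_map \<Lambda> u) \<le> 2 * nrm W (R (data_map \<Lambda> u))"
    by auto
  have "norm_WP u \<le> 2 * C * nrm W (R (data_map \<Lambda> u))"
    if wp: "well_posed \<Lambda> V norm_WP C" and u: "u \<in> U\<^sub>M" for norm_WP C u
  proof -
    have WP: "norm_WP u \<le> C * nrm V (data_map \<Lambda> u)" and nonneg: "0 \<le> norm_WP u"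
      using wp by (auto simp: well_posed_def normed_space_def)
    show ?thesis
    proof (cases "0 \<le> C")
      case True
      then show ?thesis
        using WP mult_left_mono[OF half[OF u] True] by simp
    next
      \<comment> \<open>A negative constant is possible only if all data vanish, and then the right-hand side,
        caught between 0 and the norm of the data, is 0.\<close>
      case False
      have "0 \<le> C * nrm V (data_map \<Lambda> u)"
        using WP nonneg by linarith
      then have "nrm V (data_map \<Lambda> u) \<le> 0"
        using False by (simp add: zero_le_mult_iff)
      moreover have "0 \<le> nrm V (data_map \<Lambda> u)"
        using V D by (simp add: normed_space_def)
      moreover have "nrm W (R (data_map \<Lambda> u)) \<le> nrm V (data_map \<Lambda> u)"
        by (rule MRD_restriction_le_norm[OF V assms(2) RW D])
      ultimately have "nrm V (data_map \<Lambda> u) = 0" "nrm W (R (data_map \<Lambda> u)) = 0"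
        using half[OF u] by auto
      then show ?thesis
        using WP by simp
    qed
  qed
  with RW half show ?thesis
    by (intro bexI[of _ "(R, W)"]) (auto simp: norm_D_def)
qed

end
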